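(* Let $n \geq 1$ be an integer and let $St_n$ be the star graph on $n$ vertices. Then the Bell number of its Mycielskian $M(St_n)$ is \[ B(M(St_n)) = 2\sum_{k=0}^{n-1} \binom{n-1}{k} B_{2(n-1) - k} + \sum_{i=0}^{n-1}\sum_{j=0}^{n-1} \binom{n-1}{i}\binom{n-1}{j} B_{2(n-1) - i - j}. \]
   Context: For a finite simple graph $G=(V,E)$, a proper partition of $G$ is a partition of $V$ into non-empty, pairwise disjoint subsets (parts), each of which is an independent set of $G$ (no two vertices in the same part are adjacent). The Bell number $B(G)$ of $G$ is the total number of proper partitions of $G$. $B_k$ denotes the classical $k$-th Bell number, i.e. the number of partitions of a $k$-element set into non-empty subsets, with $B_0=1$. The star $St_n$ on $n$ vertices has a center $c$ adjacent to $n-1$ leaves $v_1,\dots,v_{n-1}$, and no other edges. Its Mycielskian $M(St_n)$ is the graph on the $2n+1$ vertices $c, v_1,\dots,v_{n-1}, c', v_1',\dots,v_{n-1}', u$ whose edges are exactly: $c v_i$, $c v_i'$, $c' v_i$, and $u v_i'$ for $1\le i\le n-1$, together with $u c'$. *)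

theory Defs
  imports Complex_Main "HOL-Library.Disjoint_Sets"
begin

text \<open>A graph is a pair of a vertex set and a set of edges, an edge being a two-element set of
  vertices.\<close>

type_synonym 'a graph = "'a set \<times> 'a set set"

abbreviation verts :: "'a graph \<Rightarrow> 'a set" where
  "verts G \<equiv> fst G"

abbreviation edges :: "'a graph \<Rightarrow> 'a set set" where
  "edges G \<equiv> snd G"

definition finite_simple_graph :: "'a graph \<Rightarrow> bool" where
  "finite_simple_graph G \<longleftrightarrow>
     finite (verts G) \<and> (\<forall>e \<in> edges G. e \<subseteq> verts G \<and> card e = 2)"

definition independent_set :: "'a graph \<Rightarrow> 'a set \<Rightarrow> bool" where
  "independent_set G S \<longleftrightarrow> S \<subseteq> verts G \<and> (\<forall>x \<in> S. \<forall>y \<in> S. {x, y} \<notin> edges G)"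

definition proper_partition :: "'a graph \<Rightarrow> 'a set set \<Rightarrow> bool" where
  "proper_partition G P \<longleftrightarrow> partition_on (verts G) P \<and> (\<forall>S \<in> P. independent_set G S)"

definition graph_Bell :: "'a graph \<Rightarrow> nat" where
  "graph_Bell G = card {P. proper_partition G P}"

definition Bell :: "nat \<Rightarrow> nat" where
  "Bell k = card {P. partition_on {..<k} P}"

text \<open>The centre of the star is \<open>0\<close>, its leaves are \<open>1, \<dots>, n - 1\<close>.\<close>

definition star :: "nat \<Rightarrow> nat graph" where
  "star n = ({..<n}, {{0, i} | i. i \<in> {1..<n}})"

text \<open>\<open>Orig v\<close> is the vertex \<open>v\<close> itself, \<open>Copy v\<close> is its copy \<open>v'\<close>, and \<open>Apex\<close> is \<open>u\<close>.\<close>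

datatype 'a mycielski_vertex = Orig 'a | Copy 'a | Apex

text \<open>In the second set of edges, \<open>x\<close> and \<open>y\<close> range over both orderings of the ends of
  an edge, so that it joins \<open>x\<close> to \<open>y'\<close> as well as \<open>y\<close> to \<open>x'\<close>.\<close>

definition mycielskian :: "'a graph \<Rightarrow> 'a mycielski_vertex graph" where
  "mycielskian G =
     (Orig ` verts G \<union> Copy ` verts G \<union> {Apex},
      {{Orig x, Orig y} | x y. {x, y} \<in> edges G} \<union>
      {{Orig x, Copy y} | x y. {x, y} \<in> edges G} \<union>
      {{Copy x, Apex} | x. x \<in> verts G})"

lemma finite_simple_graph_star: "finite_simple_graph (star n)"
  by (auto simp: finite_simple_graph_def star_def)

lemma finite_simple_graph_mycielskian:
  assumes "finite_simple_graph G"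
  shows "finite_simple_graph (mycielskian G)"
proof -
  have *: "x \<in> verts G \<and> y \<in> verts G \<and> x \<noteq> y" if "{x, y} \<in> edges G" for x y
    using assms that unfolding finite_simple_graph_def by (auto simp: card_2_iff doubleton_eq_iff)
  show ?thesis
    using assms unfolding finite_simple_graph_def mycielskian_def by (auto dest: *)
qed

lemma card_verts_mycielskian_star: "card (verts (mycielskian (star n))) = 2 * n + 1"
proof -
  have "card (Orig ` {..<n} \<union> Copy ` {..<n} \<union> {Apex}) =
        card (Orig ` {..<n}) + card (Copy ` {..<n}) + 1"
    by (subst card_Un_disjoint; (subst card_Un_disjoint)?) auto
  also have "\<dots> = 2 * n + 1"
    by (simp add: card_image inj_on_def)
  finally show ?thesis by (simp add: mycielskian_def star_def)
qed

lemma edges_mycielskian_star: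
  assumes "n \<ge> 1"
  shows "edges (mycielskian (star n)) =
    (\<Union>i \<in> {1..<n}. {{Orig 0, Orig i}, {Orig 0, Copy i}, {Copy 0, Orig i}, {Apex, Copy i}})
      \<union> {{Apex, Copy 0}}"
proof -
  have v: "{..<n} = insert 0 {1..<n}"
    using assms by auto
  have e: "{x, y} \<in> edges (star n) \<longleftrightarrow>
      (x = 0 \<and> y \<in> {1..<n}) \<or> (y = 0 \<and> x \<in> {1..<n})" for x y
    unfolding star_def by (auto simp: doubleton_eq_iff)
  have 1: "{{Orig x, Orig y} | x y. {x, y} \<in> edges (star n)} =
      (\<Union>i \<in> {1..<n}. {{Orig 0, Orig i}})"
    unfolding e by blast
  have 2: "{{Orig x, Copy y} | x y. {x, y} \<in> edges (star n)} =
      (\<Union>i \<in> {1..<n}. {{Orig 0, Copy i}, {Copy 0, Orig i}})"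
    unfolding e by blast
  have 3: "{{Copy x, Apex} | x. x \<in> verts (star n)} =
      (\<Union>i \<in> {1..<n}. {{Apex, Copy i}}) \<union> {{Apex, Copy 0}}"
    unfolding star_def fst_conv v by blast
  show ?thesis
    unfolding mycielskian_def snd_conv 1 2 3 by blast
qed

lemma Bell_0: "Bell 0 = 1"
  by (simp add: Bell_def partition_on_empty)

end

theory Submission
  imports Defs
begin

text \<open>
  Counting the partitions of a finite set into independent sets can be reduced one vertex at a
  time: the block of a vertex \<open>x\<close> is \<open>insert x S\<close> for some set \<open>S\<close> of other vertices, and once \<open>S\<close>
  is chosen, what remains is an arbitrary partition of the other vertices outside \<open>S\<close> into
  independent sets (lemma \<open>card_indep_partitions_insert\<close>).

  In the Mycielskian of a star on \<open>m + 1\<close> vertices, the \<open>m\<close> leaves and their \<open>m\<close> copies together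
  form an independent set, so any \<open>k\<close> of them have \<open>Bell k\<close> partitions. All
  constraints come from the blocks of the centre \<open>c\<close>, its copy \<open>c'\<close> and the apex \<open>u\<close>. As \<open>c\<close> is
  adjacent to all leaves and copies of leaves, and \<open>u\<close> is adjacent to \<open>c'\<close>, the block of \<open>c\<close> is
  \<open>{c}\<close>, \<open>{c, c'}\<close> or \<open>{c, u}\<close>.

  \<^item> If it is \<open>{c, c'}\<close>, then \<open>u\<close> may be joined by any set of \<open>k\<close> leaves, and \<open>2 * m - k\<close> vertices
    remain. The case \<open>{c, u}\<close> is the mirror image, with \<open>c'\<close> joined by copies of leaves. The two
    cases give the single sum of the theorem twice.
  \<^item> If it is \<open>{c}\<close>, then \<open>u\<close> is joined by \<open>i\<close> leaves and \<open>c'\<close> by \<open>j\<close> copies of leaves. These choices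
    do not interfere, because leaves and copies of leaves are disjoint and \<open>u\<close> and \<open>c'\<close> never share
    a block. This gives the double sum.
\<close>

section \<open>Partitions of finite sets\<close>

lemma partition_on_image:
  assumes "partition_on A P" and "inj_on f A"
  shows "partition_on (f ` A) ((`) f ` P)"
proof -
  have "{} \<notin> (`) f ` P"
    using partition_onD3[OF assms(1)] by auto
  then show ?thesis
    using partition_on_inj_image[OF assms] by simp
qed

text \<open>As \<^term>\<open>Bell\<close> counts the partitions of one particular \<open>k\<close>-element set, partitions have to be
  carried along a bijection to count those of any other finite set.\<close>

lemma card_partitions_eq:
  assumes "bij_betw f A B"
  shows "card {P. partition_on A P} = card {P. partition_on B P}"
proof -
  define g where "g = inv_into A f"
  have inj: "inj_on f A" and B: "B = f ` A"
    using assms by (auto simp: bij_betw_def)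
  have g: "bij_betw g B A"
    unfolding g_def using assms by (rule bij_betw_inv_into)
  have gf: "g ` f ` S = S" if "S \<subseteq> A" for S
    unfolding g_def using inj that by (rule inv_into_image_cancel)
  have fg: "f ` g ` S = S" if "S \<subseteq> B" for S
    unfolding g_def using B that by (rule image_inv_into_cancel[OF sym])
  have 1: "(`) g ` (`) f ` P = P" if "partition_on A P" for P
  proof -
    have "g ` f ` S = S" if "S \<in> P" for S
      using gf that partition_onD1[OF \<open>partition_on A P\<close>] by blast
    then show ?thesis
      unfolding image_image by simp
  qed
  have 2: "(`) f ` (`) g ` P = P" if "partition_on B P" for P
  proof -
    have "f ` g ` S = S" if "S \<in> P" for S
      using fg that partition_onD1[OF \<open>partition_on B P\<close>] by blast
    then show ?thesis
      unfolding image_image by simp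
  qed
  have "bij_betw (\<lambda>P. (`) f ` P) {P. partition_on A P} {P. partition_on B P}"
    using partition_on_image[OF _ inj] partition_on_image[of B _ g] g 1 2 B
    by (intro bij_betw_byWitness[where f' = "\<lambda>P. (`) g ` P"]) (auto simp: bij_betw_def)
  then show ?thesis
    by (rule bij_betw_same_card)
qed

lemma card_partitions:
  assumes "finite A"
  shows "card {P. partition_on A P} = Bell (card A)"
proof -
  obtain f where "bij_betw f A {..<card A}"
    using ex_bij_betw_finite_nat[OF assms] by (auto simp: atLeast0LessThan)
  then show ?thesis
    unfolding Bell_def by (rule card_partitions_eq)
qed

text \<open>The summand depends on the size of the chosen set only, so grouping the subsets by size
  produces the binomial coefficients.\<close>

lemma sum_Pow_card:
  fixes f :: "nat \<Rightarrow> 'a :: semiring_1"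
  assumes "finite A"
  shows "(\<Sum>S \<in> Pow A. f (card S)) = (\<Sum>k = 0..card A. of_nat (card A choose k) * f k)"
proof -
  have "(\<Sum>S \<in> Pow A. f (card S)) =
      (\<Sum>k = 0..card A. \<Sum>S | S \<in> Pow A \<and> card S = k. f (card S))"
    using assms by (intro sum.group[symmetric]) (auto intro: card_mono)
  also have "\<dots> = (\<Sum>k = 0..card A. of_nat (card A choose k) * f k)"
    using n_subsets[OF assms] by (intro sum.cong) auto
  finally show ?thesis .
qed

section \<open>Partitions into independent sets\<close>

text \<open>The blocks partition an arbitrary set \<open>W\<close>, but they are independent in the whole graph \<open>G\<close>.
  Thus removing a block of a partition changes only \<open>W\<close>, and no induced subgraphs have to be
  formed. For \<open>W = verts G\<close> these are the proper partitions of \<open>G\<close>.\<close>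

definition indep_partitions :: "'a graph \<Rightarrow> 'a set \<Rightarrow> 'a set set set" where
  "indep_partitions G W = {P. partition_on W P \<and> (\<forall>S \<in> P. independent_set G S)}"

lemma finite_indep_partitions: "finite W \<Longrightarrow> finite (indep_partitions G W)"
  by (rule finite_subset[OF _ finitely_many_partition_on]) (auto simp: indep_partitions_def)

lemma card_indep_partitions_independent:
  assumes "finite W" and "independent_set G W"
  shows "card (indep_partitions G W) = Bell (card W)"
proof -
  have "indep_partitions G W = {P. partition_on W P}"
    using assms(2) unfolding indep_partitions_def independent_set_def partition_on_def by blast
  then show ?thesis
    using card_partitions[OF assms(1)] by simp
qed

text \<open>Removing a block of a partition leaves a partition of the rest, and putting the block back is
  the inverse operation.\<close>

lemma partition_on_insert_block:
  assumes "x \<notin> A" and "S \<subseteq> A"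
  shows "bij_betw (insert (insert x S)) {P. partition_on (A - S) P}
           {P. partition_on (insert x A) P \<and> insert x S \<in> P}"
proof -
  have diff: "insert x A - insert x S = A - S"
    using assms(1) by auto
  have split: "partition_on (insert x A) (insert (insert x S) P) \<longleftrightarrow> partition_on (A - S) P"
    if "disjnt (insert x S) (\<Union> P)" for P
    using partition_on_insert[OF that, of "insert x A"] assms(2) diff by auto
  have small: "disjnt (insert x S) (\<Union> P)" if "partition_on (A - S) P" for P
    using partition_onD1[OF that, symmetric] assms(1) by (auto simp: disjnt_def)
  have other: "disjnt (insert x S) (\<Union> (P - {insert x S}))"
    if "partition_on (insert x A) P" "insert x S \<in> P" for P
  proof -
    have "insert x S \<inter> T = {}" if "T \<in> P - {insert x S}" for T
      using that disjointD[OF partition_onD2[OF \<open>partition_on (insert x A) P\<close>]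
          \<open>insert x S \<in> P\<close>, of T] by auto
    then show ?thesis
      unfolding disjnt_def by blast
  qed
  show ?thesis
  proof (rule bij_betw_byWitness[where f' = "\<lambda>P. P - {insert x S}"])
    have "insert x S \<notin> P" if "partition_on (A - S) P" for P
      using small[OF that] unfolding disjnt_def by blast
    then show "\<forall>P \<in> {P. partition_on (A - S) P}. insert (insert x S) P - {insert x S} = P"
      by auto
    show "insert (insert x S) ` {P. partition_on (A - S) P}
        \<subseteq> {P. partition_on (insert x A) P \<and> insert x S \<in> P}"
      using split small by blast
    have "partition_on (A - S) (P - {insert x S})"
      if "partition_on (insert x A) P" "insert x S \<in> P" for P
      using split[OF other[OF that]] that by (simp only: insert_Diff simp_thms)
    then show "(\<lambda>P. P - {insert x S}) ` {P. partition_on (insert x A) P \<and> insert x S \<in> P}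
        \<subseteq> {P. partition_on (A - S) P}"
      by blast
    show "\<forall>P \<in> {P. partition_on (insert x A) P \<and> insert x S \<in> P}.
        insert (insert x S) (P - {insert x S}) = P"
      using insert_Diff[of "insert x S"] by blast
  qed
qed

text \<open>Every partition of \<open>insert x A\<close> has exactly one block that contains \<open>x\<close>. The set \<open>S\<close> of the
  other elements of this block classifies the partitions.\<close>

lemma card_indep_partitions_insert:
  assumes "finite A" and "x \<notin> A"
  shows "card (indep_partitions G (insert x A)) =
    (\<Sum>S | S \<subseteq> A \<and> independent_set G (insert x S). card (indep_partitions G (A - S)))"
proof -
  define F where "F = {S. S \<subseteq> A \<and> independent_set G (insert x S)}"
  define B where "B S = {P \<in> indep_partitions G (insert x A). insert x S \<in> P}" for S
  have finF: "finite F"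
    unfolding F_def using assms(1) by simp
  have finB: "finite (B S)" for S
    unfolding B_def using assms(1) by (simp add: finite_indep_partitions)
  have "P \<in> (\<Union>S \<in> F. B S)" if P: "P \<in> indep_partitions G (insert x A)" for P
  proof -
    obtain T where T: "T \<in> P" "x \<in> T"
      using P by (auto simp: indep_partitions_def partition_on_def)
    then have "T - {x} \<in> F" "insert x (T - {x}) = T"
      using P by (auto simp: F_def indep_partitions_def partition_on_def insert_absorb)
    then have "P \<in> B (T - {x})"
      using P T by (simp add: B_def)
    then show ?thesis
      using \<open>T - {x} \<in> F\<close> by blast
  qed
  then have cover: "indep_partitions G (insert x A) = (\<Union>S \<in> F. B S)"
    by (auto simp: B_def)
  have disj: "B S \<inter> B T = {}" if "S \<in> F" "T \<in> F" "S \<noteq> T" for S T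
  proof -
    have "insert x S = insert x T" if "P \<in> B S" "P \<in> B T" for P
    proof -
      have "disjoint P" "insert x S \<in> P" "insert x T \<in> P"
        using that by (auto simp: B_def indep_partitions_def partition_on_def)
      then show ?thesis
        using disjointD[of P "insert x S" "insert x T"] by blast
    qed
    moreover have "insert x S \<noteq> insert x T"
      using that assms(2) unfolding F_def by (auto simp: insert_ident)
    ultimately show ?thesis
      by blast
  qed
  have "card (B S) = card (indep_partitions G (A - S))" if "S \<in> F" for S
  proof -
    have S: "S \<subseteq> A" "independent_set G (insert x S)"
      using that by (auto simp: F_def)
    have bij: "bij_betw (insert (insert x S)) {P. partition_on (A - S) P}
           {P. partition_on (insert x A) P \<and> insert x S \<in> P}"
      using assms(2) S(1) by (rule partition_on_insert_block)
    have "insert (insert x S) ` indep_partitions G (A - S) = B S"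
    proof
      show "insert (insert x S) ` indep_partitions G (A - S) \<subseteq> B S"
        using bij_betw_imp_surj_on[OF bij] S(2) unfolding B_def indep_partitions_def by auto
      show "B S \<subseteq> insert (insert x S) ` indep_partitions G (A - S)"
      proof
        fix P assume "P \<in> B S"
        then have P: "P \<in> {P. partition_on (insert x A) P \<and> insert x S \<in> P}"
            and ind: "\<forall>T \<in> P. independent_set G T"
          by (auto simp: B_def indep_partitions_def)
        obtain Q where "partition_on (A - S) Q" "P = insert (insert x S) Q"
          using P bij_betw_imp_surj_on[OF bij] by blast
        then show "P \<in> insert (insert x S) ` indep_partitions G (A - S)"
          using ind by (auto simp: indep_partitions_def)
      qed
    qed
    moreover have "inj_on (insert (insert x S)) (indep_partitions G (A - S))"
      by (rule inj_on_subset[OF bij_betw_imp_inj_on[OF bij]]) (auto simp: indep_partitions_def)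
    ultimately show ?thesis
      using card_image by metis
  qed
  then show ?thesis
    unfolding cover F_def[symmetric]
    using card_UN_disjoint[OF finF, of B] finB disj by simp
qed

section \<open>The Mycielskian of a star\<close>

text \<open>Every edge has the centre, its copy or the apex as an end. So it is enough to list the
  non-neighbours of these three vertices.\<close>

lemma independent_set_mycielskian_star:
  assumes "n \<ge> 1"
  shows "independent_set (mycielskian (star n)) S \<longleftrightarrow>
    S \<subseteq> verts (mycielskian (star n)) \<and>
    (Orig 0 \<in> S \<longrightarrow> S \<subseteq> {Orig 0, Copy 0, Apex}) \<and>
    (Copy 0 \<in> S \<longrightarrow> S \<subseteq> {Orig 0, Copy 0} \<union> Copy ` {1..<n}) \<and>
    (Apex \<in> S \<longrightarrow> S \<subseteq> {Orig 0, Apex} \<union> Orig ` {1..<n})"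
proof (cases "S \<subseteq> verts (mycielskian (star n))")
  case True
  have v: "verts (mycielskian (star n)) =
      {Orig 0, Copy 0, Apex} \<union> Orig ` {1..<n} \<union> Copy ` {1..<n}"
    using assms by (auto simp: mycielskian_def star_def image_iff)
  have edges: "(\<forall>x \<in> S. \<forall>y \<in> S. {x, y} \<notin> edges (mycielskian (star n))) \<longleftrightarrow>
     (\<forall>i \<in> {1..<n}. \<not> (Orig 0 \<in> S \<and> Orig i \<in> S) \<and> \<not> (Orig 0 \<in> S \<and> Copy i \<in> S) \<and>
         \<not> (Copy 0 \<in> S \<and> Orig i \<in> S) \<and> \<not> (Apex \<in> S \<and> Copy i \<in> S)) \<and>
         \<not> (Apex \<in> S \<and> Copy 0 \<in> S)"
    unfolding edges_mycielskian_star[OF assms] by (auto simp: doubleton_eq_iff)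
  have centre: "S \<subseteq> {Orig 0, Copy 0, Apex} \<longleftrightarrow> (\<forall>i \<in> {1..<n}. Orig i \<notin> S \<and> Copy i \<notin> S)"
    using True unfolding v by fastforce
  have copy: "S \<subseteq> {Orig 0, Copy 0} \<union> Copy ` {1..<n} \<longleftrightarrow>
      Apex \<notin> S \<and> (\<forall>i \<in> {1..<n}. Orig i \<notin> S)"
    using True unfolding v by fastforce
  have apex: "S \<subseteq> {Orig 0, Apex} \<union> Orig ` {1..<n} \<longleftrightarrow>
      Copy 0 \<notin> S \<and> (\<forall>i \<in> {1..<n}. Copy i \<notin> S)"
    using True unfolding v by fastforce
  show ?thesis
    unfolding independent_set_def edges centre copy apex using True by blast
qed (simp add: independent_set_def)

theorem theorem3:
  fixes n :: nat
  assumes "n \<ge> 1"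
  shows "graph_Bell (mycielskian (star n)) =
    2 * (\<Sum>k = 0..n - 1. ((n - 1) choose k) * Bell (2 * (n - 1) - k)) +
    (\<Sum>i = 0..n - 1. \<Sum>j = 0..n - 1.
       ((n - 1) choose i) * ((n - 1) choose j) * Bell (2 * (n - 1) - i - j))"
proof -
  define G where "G = mycielskian (star n)"
  define m where "m = n - 1"
  define V :: "nat mycielski_vertex set" where "V = Orig ` {1..<n}"
  define W :: "nat mycielski_vertex set" where "W = Copy ` {1..<n}"
  let ?c = "Orig 0 :: nat mycielski_vertex" and ?c' = "Copy 0 :: nat mycielski_vertex"
  let ?N = "\<lambda>X. card (indep_partitions G X)"
  have fin: "finite V" "finite W" and card: "card V = m" "card W = m"
    by (auto simp: V_def W_def m_def card_image inj_on_def)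
  have new: "?c \<notin> V" "?c \<notin> W" "?c' \<notin> V" "?c' \<notin> W" "Apex \<notin> V" "Apex \<notin> W" "V \<inter> W = {}"
    by (auto simp: V_def W_def)
  have verts: "verts G = insert ?c (insert ?c' (insert Apex (V \<union> W)))"
    unfolding G_def V_def W_def using assms by (auto simp: mycielskian_def star_def image_iff)
  have ind: "independent_set G S \<longleftrightarrow> S \<subseteq> verts G \<and>
      (?c \<in> S \<longrightarrow> S \<subseteq> {?c, ?c', Apex}) \<and> (?c' \<in> S \<longrightarrow> S \<subseteq> {?c, ?c'} \<union> W) \<and>
      (Apex \<in> S \<longrightarrow> S \<subseteq> {?c, Apex} \<union> V)" for S
    unfolding G_def V_def W_def by (rule independent_set_mycielskian_star[OF assms])

  have leaves: "?N (V \<union> W - S - T) = Bell (2 * m - card S - card T)"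
    if "S \<subseteq> V" "T \<subseteq> W" for S T
  proof -
    have "independent_set G (V \<union> W - S - T)"
      unfolding ind verts using new by blast
    moreover have "card (V \<union> W - S - T) = 2 * m - card S - card T"
    proof -
      have "V \<union> W - S - T = (V - S) \<union> (W - T)"
        using that new by auto
      then show ?thesis
        using that fin card new card_mono[OF fin(1) that(1)] card_mono[OF fin(2) that(2)]
        by (subst \<open>V \<union> W - S - T = _\<close>, subst card_Un_disjoint)
           (auto simp: card_Diff_subset finite_subset)
    qed
    ultimately show ?thesis
      using fin by (simp add: card_indep_partitions_independent)
  qed

  \<comment> \<open>A set \<open>T\<close> of copies of leaves may already have been used up in the block of \<open>c'\<close>; the
    case where \<open>c'\<close> shares the block of the centre is \<open>T = {}\<close>.\<close>
  have apex: "?N (insert Apex (V \<union> W - T)) = (\<Sum>i = 0..m. (m choose i) * Bell (2 * m - i - card T))"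
    if "T \<subseteq> W" for T
  proof -
    have "?N (insert Apex (V \<union> W - T)) =
        (\<Sum>S | S \<subseteq> V \<union> W - T \<and> independent_set G (insert Apex S). ?N (V \<union> W - T - S))"
      using fin new by (intro card_indep_partitions_insert) auto
    also have "{S. S \<subseteq> V \<union> W - T \<and> independent_set G (insert Apex S)} = Pow V"
      unfolding ind verts using new that by (auto; blast)
    also have "(\<Sum>S \<in> Pow V. ?N (V \<union> W - T - S)) =
        (\<Sum>S \<in> Pow V. Bell (2 * m - card S - card T))"
      using leaves that by (intro sum.cong) (auto simp: Diff_eq Int_ac)
    also have "\<dots> = (\<Sum>i = 0..m. (m choose i) * Bell (2 * m - i - card T))"
      using sum_Pow_card[OF fin(1), of "\<lambda>i. Bell (2 * m - i - card T)"] card by simp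
    finally show ?thesis .
  qed

  \<comment> \<open>The vertex \<open>c'\<close> is adjacent to the apex, so its block is the same whether or not the apex is
    still there.\<close>
  have copy: "?N (insert ?c' X) = (\<Sum>T \<in> Pow W. ?N (X - T))"
    if "X = V \<union> W \<or> X = insert Apex (V \<union> W)" for X
  proof -
    have "?N (insert ?c' X) =
        (\<Sum>T | T \<subseteq> X \<and> independent_set G (insert ?c' T). ?N (X - T))"
      using fin new that by (intro card_indep_partitions_insert) auto
    also have "{T. T \<subseteq> X \<and> independent_set G (insert ?c' T)} = Pow W"
      unfolding ind verts using new that by (auto; blast)
    finally show ?thesis .
  qed

  let ?s = "\<Sum>k = 0..m. (m choose k) * Bell (2 * m - k)"
  have c_alone: "?N (insert ?c' (insert Apex (V \<union> W))) =
      (\<Sum>i = 0..m. \<Sum>j = 0..m. (m choose i) * (m choose j) * Bell (2 * m - i - j))"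
  proof -
    have "?N (insert ?c' (insert Apex (V \<union> W))) = (\<Sum>T \<in> Pow W. ?N (insert Apex (V \<union> W - T)))"
      using copy[of "insert Apex (V \<union> W)"] new
      by (auto simp: insert_Diff_if intro!: sum.cong)
    also have "\<dots> = (\<Sum>T \<in> Pow W. \<Sum>i = 0..m. (m choose i) * Bell (2 * m - i - card T))"
      using apex by (intro sum.cong) auto
    also have "\<dots> = (\<Sum>j = 0..m. (m choose j) * (\<Sum>i = 0..m. (m choose i) * Bell (2 * m - i - j)))"
      using sum_Pow_card[OF fin(2), of "\<lambda>j. \<Sum>i = 0..m. (m choose i) * Bell (2 * m - i - j)"] card
      by simp
    also have "\<dots> = (\<Sum>j = 0..m. \<Sum>i = 0..m. (m choose i) * (m choose j) * Bell (2 * m - i - j))"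
      by (simp add: sum_distrib_left mult_ac)
    also have "\<dots> = (\<Sum>i = 0..m. \<Sum>j = 0..m. (m choose i) * (m choose j) * Bell (2 * m - i - j))"
      by (rule sum.swap)
    finally show ?thesis .
  qed
  have c_copy: "?N (insert Apex (V \<union> W)) = ?s"
    using apex[of "{}"] by simp
  have c_apex: "?N (insert ?c' (V \<union> W)) = ?s"
  proof -
    have "?N (insert ?c' (V \<union> W)) = (\<Sum>T \<in> Pow W. Bell (2 * m - card T))"
      using copy[of "V \<union> W"] leaves[of "{}"] by (auto intro!: sum.cong)
    then show ?thesis
      using sum_Pow_card[OF fin(2), of "\<lambda>k. Bell (2 * m - k)"] card by simp
  qed

  let ?A = "insert ?c' (insert Apex (V \<union> W))"
  have "graph_Bell G = ?N (verts G)"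
    by (simp add: graph_Bell_def proper_partition_def indep_partitions_def)
  also have "\<dots> = (\<Sum>S | S \<subseteq> ?A \<and> independent_set G (insert ?c S). ?N (?A - S))"
    unfolding verts using fin new by (intro card_indep_partitions_insert) auto
  also have "{S. S \<subseteq> ?A \<and> independent_set G (insert ?c S)} = {{}, {?c'}, {Apex}}"
  proof (intro subset_antisym subsetI)
    fix S assume "S \<in> {S. S \<subseteq> ?A \<and> independent_set G (insert ?c S)}"
    then have S: "S \<subseteq> ?A" "independent_set G (insert ?c S)"
      by auto
    have "insert ?c S \<subseteq> {?c, ?c', Apex}" and "?c' \<in> S \<longrightarrow> insert ?c S \<subseteq> {?c, ?c'} \<union> W"
      using S(2) unfolding ind by auto
    moreover have "?c \<notin> S"
      using S(1) new by auto
    ultimately have "S \<subseteq> {?c', Apex}" "?c' \<in> S \<longrightarrow> Apex \<notin> S"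
      using new by auto
    then show "S \<in> {{}, {?c'}, {Apex}}"
      by blast
  next
    fix S assume "S \<in> {{}, {?c'}, {Apex}}"
    then consider "S = {}" | "S = {?c'}" | "S = {Apex}"
      by blast
    then show "S \<in> {S. S \<subseteq> ?A \<and> independent_set G (insert ?c S)}"
      unfolding ind verts by cases auto
  qed
  also have "(\<Sum>S \<in> {{}, {?c'}, {Apex}}. ?N (?A - S)) =
      ?N ?A + ?N (insert Apex (V \<union> W)) + ?N (insert ?c' (V \<union> W))"
    using new by (simp add: insert_Diff_if)
  finally show ?thesis
    unfolding c_alone c_copy c_apex by (simp add: G_def m_def)
qed

end
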